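(* Assume there are constants $K_1,K_{\partial\Omega,\Omega}$ such that for all $f\in C^1(\Omega)$ $$\mathrm{Var}_{\sigma_\beta}(f)\le K_{\partial\Omega,\Omega}\int_\Omega|\nabla f|^2\,d\lambda_\alpha,\qquad\left(\int_\Omega f\,d\lambda_\alpha-\int_{\partial\Omega}f\,d\sigma_\beta\right)^2\le K_1\int_\Omega|\nabla f|^2\,d\lambda_\alpha .$$ Then $$\hat C_\mu\le C_{\lambda_\alpha}+\frac{B\,K_{\partial\Omega,\Omega}}{A}+B\,K_1 .$$
   Context: Setting and notation. $\Omega$ is a smooth compact connected Riemannian manifold of dimension $d\ge2$ with smooth connected boundary $\partial\Omega$ (the boundary is included in $\Omega$). $\lambda$ is the volume measure on $\Omega$, $\sigma$ the Hausdorff (surface) measure on $\partial\Omega$, $\nabla$ the gradient on $\Omega$, $\nabla^\tau$ the tangential gradient on $\partial\Omega$. $C^1(\Omega)$ denotes functions that are $C^1$ up to the boundary; integrals over $\partial\Omega$ of functions on $\Omega$ use their restriction (trace). $\alpha,\beta:\Omega\to\mathbb{R}$ are weights, $A:=\int_\Omega\alpha\,d\lambda$, $B:=\int_{\partial\Omega}\beta\,d\sigma$, $d\lambda_\alpha:=\frac{\alpha}{A}d\lambda$, $d\sigma_\beta:=\frac{\beta}{B}d\sigma$, $d\mu:=\alpha\,d\lambda+\beta\,d\sigma$. For a probability measure $\nu$: $\mathrm{Var}_\nu(f)=\int f^2d\nu-(\int f\,d\nu)^2$ and $\mathrm{Ent}_\nu(f^2)=\int f^2\ln(f^2)d\nu-\int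 f^2d\nu\,\ln\int f^2d\nu$. Standing assumptions. (1) $\mu$ is a probability measure, with $A,B\in(0,1)$, $A+B=1$. (2) $\alpha,\beta\in C(\Omega)$, $\alpha>0$ $\lambda$-a.e. on $\Omega$, $\beta>0$ $\sigma$-a.e. on $\partial\Omega$, $\sqrt\alpha\in W^{1,2}(\Omega)$, $\sqrt\beta\in W^{1,2}(\partial\Omega)$ (the last condition is not used in the present case without boundary diffusion). (3) The constants $C_{\lambda_\alpha},L_{\lambda_\alpha},C_{\sigma_\beta},L_{\sigma_\beta}$ are finite, where these are the smallest constants with $\mathrm{Var}_{\lambda_\alpha}(f)\le C_{\lambda_\alpha}\int_\Omega|\nabla f|^2d\lambda_\alpha$ and $\mathrm{Ent}_{\lambda_\alpha}(f^2)\le L_{\lambda_\alpha}\int_\Omega|\nabla f|^2d\lambda_\alpha$ for all $f\in C^1(\Omega)$, and $\mathrm{Var}_{\sigma_\beta}(f)\le C_{\sigma_\beta}\int_{\partial\Omega}|\nabla^\tau f|^2d\sigma_\beta$ and $\mathrm{Ent}_{\sigma_\beta}(f^2)\le L_{\sigma_\beta}\int_{\partial\Omega}|\nabla^\tau f|^2d\sigma_\beta$ for all $f\in C^1(\partial\Omega)$. (4) The following embeddings/traces hold: $W^{1,2}(\Omega,\alpha d\lambda)\to L^2(\Omega,\alpha d\lambda)$ compactly; $W^{1,2}(\Omega,\alpha d\lambda)\to L^p(\Omega,\beta d\lambda)$ for $p\in[2,\frac{2d-2}{d-2}]$; $W^{1,2}(\partial\Omega,\beta d\sigma)\to L^2(\partial\Omega,\beta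 d\sigma)$ compactly; the trace $W^{1,2}(\Omega,\alpha d\lambda)\to L^2(\partial\Omega,\beta d\sigma)$ compactly. $\hat C_\mu$ is the smallest constant such that $\mathrm{Var}_\mu(f)\le\hat C_\mu\int_\Omega|\nabla f|^2\alpha\,d\lambda$ for all $f\in C^1(\Omega)$. *)

theory Defs
  imports "HOL-Analysis.Analysis" "HOL-Probability.Probability_Measure"
begin

section \<open>Differentiability classes on subsets of Euclidean space\<close>

text \<open>\<open>Ck_open k f U\<close>: class \<open>C^k\<close> on an open set \<open>U\<close>, through iterated partial derivatives.\<close>

primrec Ck_open ::
  "nat \<Rightarrow> ('e::euclidean_space \<Rightarrow> 'b::real_normed_vector) \<Rightarrow> 'e set \<Rightarrow> bool" where
  "Ck_open 0 f U \<longleftrightarrow> continuous_on U f"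
| "Ck_open (Suc k) f U \<longleftrightarrow>
     f differentiable_on U \<and> (\<forall>i\<in>Basis. Ck_open k (\<lambda>x. frechet_derivative f (at x) i) U)"

text \<open>Class \<open>C^k\<close> (\<open>k = \<infinity>\<close>: smooth) on an arbitrary set \<open>V\<close>: every point of \<open>V\<close> has an open
  neighbourhood on which \<open>f\<close> extends to a \<open>C^k\<close> function. For relatively open subsets of a
  half-space this is differentiability up to the boundary; for relatively open subsets of a
  hyperplane it is differentiability along the hyperplane.\<close>

definition Ck_on ::
  "enat \<Rightarrow> ('e::euclidean_space \<Rightarrow> 'b::real_normed_vector) \<Rightarrow> 'e set \<Rightarrow> bool" where
  "Ck_on k f V \<longleftrightarrow>
     (\<forall>x\<in>V. \<exists>W F. open W \<and> x \<in> W \<and> (\<forall>n. enat n \<le> k \<longrightarrow> Ck_open n F W) \<and>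
                  (\<forall>y\<in>V \<inter> W. F y = f y))"


section \<open>Riemannian manifolds with boundary\<close>

text \<open>A chart is a pair of its domain and its coordinate map (relevant on the domain only).
  \<open>rmetric M c x u v\<close> is the Riemannian metric in the coordinates of the chart \<open>c\<close>, evaluated at
  the coordinate point \<open>x\<close> on the coordinate vectors \<open>u\<close>, \<open>v\<close>.\<close>

type_synonym ('a, 'n) chart = "'a set \<times> ('a \<Rightarrow> real ^ 'n)"

record ('a, 'n) rmanifold =
  mtop :: "'a topology"
  atlas :: "('a, 'n) chart set"
  rmetric :: "('a, 'n) chart \<Rightarrow> real ^ 'n \<Rightarrow> real ^ 'n \<Rightarrow> real ^ 'n \<Rightarrow> real"

text \<open>The model half-space; which coordinate is singled out as the normal one is immaterial.\<close>

definition normal_index :: "'n::finite" where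
  "normal_index = (SOME i. True)"

definition half_space :: "(real ^ 'n::finite) set" where
  "half_space = {x. 0 \<le> x $ normal_index}"

definition hyperplane :: "(real ^ 'n::finite) set" where
  "hyperplane = {x. x $ normal_index = 0}"

abbreviation chart_inv :: "('a, 'n) chart \<Rightarrow> real ^ 'n \<Rightarrow> 'a" where
  "chart_inv c \<equiv> inv_into (fst c) (snd c)"

definition smooth_manifold_with_boundary :: "('a, 'n::finite) rmanifold \<Rightarrow> bool" where
  "smooth_manifold_with_boundary M \<longleftrightarrow>
     Hausdorff_space (mtop M) \<and> second_countable (mtop M) \<and>
     topspace (mtop M) = \<Union> (fst ` atlas M) \<and>
     (\<forall>c\<in>atlas M.
        openin (mtop M) (fst c) \<and>
        openin (top_of_set half_space) (snd c ` fst c) \<and>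
        homeomorphic_map (subtopology (mtop M) (fst c)) (top_of_set (snd c ` fst c)) (snd c)) \<and>
     (\<forall>c\<in>atlas M. \<forall>c'\<in>atlas M. Ck_on \<infinity> (snd c' \<circ> chart_inv c) (snd c ` (fst c \<inter> fst c')))"

text \<open>The last conjunct is the transformation rule of the metric under changes of charts. The
  derivative within a relatively open subset of the half-space is unique, also at boundary points.\<close>

definition riemannian_manifold_with_boundary :: "('a, 'n::finite) rmanifold \<Rightarrow> bool" where
  "riemannian_manifold_with_boundary M \<longleftrightarrow>
     smooth_manifold_with_boundary M \<and>
     (\<forall>c\<in>atlas M. \<forall>x\<in>snd c ` fst c.
        bilinear (rmetric M c x) \<and>
        (\<forall>u v. rmetric M c x u v = rmetric M c x v u) \<and>
        (\<forall>u. u \<noteq> 0 \<longrightarrow> 0 < rmetric M c x u u)) \<and>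
     (\<forall>c\<in>atlas M. \<forall>u v. Ck_on \<infinity> (\<lambda>x. rmetric M c x u v) (snd c ` fst c)) \<and>
     (\<forall>c\<in>atlas M. \<forall>c'\<in>atlas M. \<forall>p\<in>fst c \<inter> fst c'. \<forall>u v.
        (let D = frechet_derivative (snd c' \<circ> chart_inv c)
                   (at (snd c p) within snd c ` (fst c \<inter> fst c'))
         in rmetric M c (snd c p) u v = rmetric M c' (snd c' p) (D u) (D v)))"

definition boundary :: "('a, 'n::finite) rmanifold \<Rightarrow> 'a set" where
  "boundary M = {p. \<exists>c\<in>atlas M. p \<in> fst c \<and> snd c p \<in> hyperplane}"

text \<open>A chart around \<open>p\<close>; it is only used for quantities that do not depend on the chart.\<close>

definition chart_at :: "('a, 'n::finite) rmanifold \<Rightarrow> 'a \<Rightarrow> ('a, 'n) chart" where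
  "chart_at M p = (SOME c. c \<in> atlas M \<and> p \<in> fst c)"


section \<open>Differentiable functions and gradients\<close>

text \<open>\<open>C^1(\<Omega>)\<close> (up to the boundary) and \<open>C^1(\<partial>\<Omega>)\<close>. Only the values on the manifold,
  respectively on its boundary, matter.\<close>

definition C1 :: "('a, 'n::finite) rmanifold \<Rightarrow> ('a \<Rightarrow> real) set" where
  "C1 M = {f. \<forall>c\<in>atlas M. Ck_on 1 (f \<circ> chart_inv c) (snd c ` fst c)}"

definition C1_boundary :: "('a, 'n::finite) rmanifold \<Rightarrow> ('a \<Rightarrow> real) set" where
  "C1_boundary M = {f. \<forall>c\<in>atlas M. Ck_on 1 (f \<circ> chart_inv c) (snd c ` (fst c \<inter> boundary M))}"

text \<open>Coordinates of the gradient in the chart \<open>c\<close>: the vector dual to the differential.\<close>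

definition grad ::
  "('a, 'n::finite) rmanifold \<Rightarrow> ('a, 'n) chart \<Rightarrow> ('a \<Rightarrow> real) \<Rightarrow> 'a \<Rightarrow> real ^ 'n" where
  "grad M c f p = (THE v. \<forall>w. rmetric M c (snd c p) v w =
     frechet_derivative (f \<circ> chart_inv c) (at (snd c p) within snd c ` fst c) w)"

definition tangential_grad ::
  "('a, 'n::finite) rmanifold \<Rightarrow> ('a, 'n) chart \<Rightarrow> ('a \<Rightarrow> real) \<Rightarrow> 'a \<Rightarrow> real ^ 'n" where
  "tangential_grad M c f p = (THE v. v \<in> hyperplane \<and>
     (\<forall>w\<in>hyperplane. rmetric M c (snd c p) v w =
        frechet_derivative (f \<circ> chart_inv c)
          (at (snd c p) within snd c ` (fst c \<inter> boundary M)) w))"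

definition grad_sq :: "('a, 'n::finite) rmanifold \<Rightarrow> ('a \<Rightarrow> real) \<Rightarrow> 'a \<Rightarrow> real" where
  "grad_sq M f p = (let c = chart_at M p; v = grad M c f p in rmetric M c (snd c p) v v)"

definition tangential_grad_sq :: "('a, 'n::finite) rmanifold \<Rightarrow> ('a \<Rightarrow> real) \<Rightarrow> 'a \<Rightarrow> real" where
  "tangential_grad_sq M f p =
     (let c = chart_at M p; v = tangential_grad M c f p in rmetric M c (snd c p) v v)"


section \<open>Volume and surface measure\<close>

definition borel_of :: "'a topology \<Rightarrow> 'a measure" where
  "borel_of X = sigma (topspace X) {U. openin X U}"

definition gram :: "('a, 'n::finite) rmanifold \<Rightarrow> ('a, 'n) chart \<Rightarrow> real ^ 'n \<Rightarrow> real ^ 'n ^ 'n" where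
  "gram M c x = (\<chi> i j. rmetric M c x (axis i 1) (axis j 1))"

definition riemannian_volume :: "('a, 'n::finite) rmanifold \<Rightarrow> 'a measure \<Rightarrow> bool" where
  "riemannian_volume M lam \<longleftrightarrow>
     space lam = topspace (mtop M) \<and> sets lam = sets (borel_of (mtop M)) \<and>
     (\<forall>c\<in>atlas M. \<forall>S\<in>sets lam. S \<subseteq> fst c \<longrightarrow>
        emeasure lam S = (\<integral>\<^sup>+x\<in>snd c ` S. ennreal (sqrt (det (gram M c x))) \<partial>lborel))"

definition piecewise_C1_curve :: "('a, 'n::finite) rmanifold \<Rightarrow> (real \<Rightarrow> 'a) \<Rightarrow> bool" where
  "piecewise_C1_curve M \<gamma> \<longleftrightarrow>
     continuous_map (top_of_set {0..1}) (mtop M) \<gamma> \<and>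
     (\<forall>c\<in>atlas M. \<forall>a b. 0 \<le> a \<and> a < b \<and> b \<le> 1 \<and> \<gamma> ` {a..b} \<subseteq> fst c \<longrightarrow>
        (snd c \<circ> \<gamma>) piecewise_C1_differentiable_on {a..b})"

definition speed :: "('a, 'n::finite) rmanifold \<Rightarrow> (real \<Rightarrow> 'a) \<Rightarrow> real \<Rightarrow> real" where
  "speed M \<gamma> t =
     (let c = chart_at M (\<gamma> t); v = vector_derivative (snd c \<circ> \<gamma>) (at t)
      in sqrt (rmetric M c (snd c (\<gamma> t)) v v))"

definition riemannian_dist :: "('a, 'n::finite) rmanifold \<Rightarrow> 'a \<Rightarrow> 'a \<Rightarrow> ennreal" where
  "riemannian_dist M p q =
     (INF \<gamma>\<in>{\<gamma>. piecewise_C1_curve M \<gamma> \<and> \<gamma> 0 = p \<and> \<gamma> 1 = q}.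
        \<integral>\<^sup>+t\<in>{0..1}. ennreal (speed M \<gamma> t) \<partial>lborel)"

definition diam :: "('a \<Rightarrow> 'a \<Rightarrow> ennreal) \<Rightarrow> 'a set \<Rightarrow> ennreal" where
  "diam D E = (SUP (x, y)\<in>E \<times> E. D x y)"

text \<open>\<open>s\<close>-dimensional Hausdorff outer measure (\<open>s \<ge> 1\<close>), normalised so that it agrees with
  Lebesgue measure on \<open>s\<close>-dimensional Euclidean space.\<close>

definition hausdorff_outer :: "nat \<Rightarrow> ('a \<Rightarrow> 'a \<Rightarrow> ennreal) \<Rightarrow> 'a set \<Rightarrow> ennreal" where
  "hausdorff_outer s D S =
     (SUP \<delta>\<in>{\<delta>::real. 0 < \<delta>}.
        INF E\<in>{E :: nat \<Rightarrow> 'a set. S \<subseteq> (\<Union>n. E n) \<and> (\<forall>n. diam D (E n) \<le> ennreal \<delta>)}.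
          \<Sum>n. ennreal (unit_ball_vol (real s) / 2 ^ s) * diam D (E n) ^ s)"

definition hausdorff_surface_measure :: "('a, 'n::finite) rmanifold \<Rightarrow> 'a measure \<Rightarrow> bool" where
  "hausdorff_surface_measure M \<sigma> \<longleftrightarrow>
     space \<sigma> = boundary M \<and> sets \<sigma> = sets (borel_of (subtopology (mtop M) (boundary M))) \<and>
     (\<forall>S\<in>sets \<sigma>. emeasure \<sigma> S = hausdorff_outer (CARD('n) - 1) (riemannian_dist M) S)"

text \<open>A weight that takes negative values enters through its positive part.\<close>

abbreviation weighted :: "'a measure \<Rightarrow> ('a \<Rightarrow> real) \<Rightarrow> 'a measure" where
  "weighted \<nu> w \<equiv> density \<nu> (\<lambda>x. ennreal (w x))"

text \<open>The measure \<open>\<alpha> d\<lambda> + \<beta> d\<sigma>\<close> on \<open>\<Omega>\<close>, where \<open>\<sigma>\<close> lives on the boundary.\<close>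

definition sticky_measure ::
  "('a, 'n::finite) rmanifold \<Rightarrow> 'a measure \<Rightarrow> 'a measure \<Rightarrow> ('a \<Rightarrow> real) \<Rightarrow> ('a \<Rightarrow> real) \<Rightarrow> 'a measure"
  where
  "sticky_measure M lam \<sigma> \<alpha> \<beta> =
     measure_of (topspace (mtop M)) (sets (borel_of (mtop M)))
       (\<lambda>S. emeasure (weighted lam \<alpha>) S + emeasure (weighted \<sigma> \<beta>) (S \<inter> boundary M))"

lemma space_borel_of [simp]: "space (borel_of X) = topspace X"
  by (simp add: borel_of_def space_measure_of_conv)

lemma sets_borel_of: "sets (borel_of X) = sigma_sets (topspace X) {U. openin X U}"
  unfolding borel_of_def by (rule sets_measure_of) (auto dest: openin_subset)

lemma sets_borel_of_Int:
  assumes "S \<in> sets (borel_of X)"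
  shows "S \<inter> Y \<in> sets (borel_of (subtopology X Y))"
proof -
  have "(\<lambda>x. x) \<in> borel_of (subtopology X Y) \<rightarrow>\<^sub>M borel_of X"
    unfolding borel_of_def[of X]
  proof (rule measurable_measure_of)
    show "{U. openin X U} \<subseteq> Pow (topspace X)"
      by (auto dest: openin_subset)
    show "(\<lambda>x. x) \<in> space (borel_of (subtopology X Y)) \<rightarrow> topspace X"
      by simp
    fix U assume "U \<in> {U. openin X U}"
    then have U: "openin X U" "U \<subseteq> topspace X"
      by (auto dest: openin_subset)
    have "openin (subtopology X Y) (U \<inter> Y)"
      using U by (auto simp: openin_subtopology)
    moreover have "(\<lambda>x. x) -` U \<inter> space (borel_of (subtopology X Y)) = U \<inter> Y"
      using U by auto
    ultimately show "(\<lambda>x. x) -` U \<inter> space (borel_of (subtopology X Y))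
        \<in> sets (borel_of (subtopology X Y))"
      by (simp only: sets_borel_of) (blast intro: sigma_sets.Basic)
  qed
  from measurable_sets[OF this assms]
  have "S \<inter> (topspace X \<inter> Y) \<in> sets (borel_of (subtopology X Y))"
    by simp
  moreover have "S \<subseteq> topspace X"
    using sets.sets_into_space[OF assms] by simp
  ultimately show ?thesis
    by (metis Int_absorb2 Int_assoc)
qed

lemma emeasure_sticky_measure:
  assumes lam: "sets lam = sets (borel_of (mtop M))"
    and \<sigma>: "sets \<sigma> = sets (borel_of (subtopology (mtop M) (boundary M)))"
    and S: "S \<in> sets (borel_of (mtop M))"
  shows "emeasure (sticky_measure M lam \<sigma> \<alpha> \<beta>) S =
    emeasure (weighted lam \<alpha>) S + emeasure (weighted \<sigma> \<beta>) (S \<inter> boundary M)"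
proof (rule emeasure_measure_of[OF sticky_measure_def])
  show "sets (borel_of (mtop M)) \<subseteq> Pow (topspace (mtop M))"
    using sets.sets_into_space by fastforce
  have eq: "sets (sticky_measure M lam \<sigma> \<alpha> \<beta>) = sets (borel_of (mtop M))"
    unfolding sticky_measure_def
    by (metis sets.sets_measure_of_eq space_borel_of)
  then show "S \<in> sets (sticky_measure M lam \<sigma> \<alpha> \<beta>)"
    using S by simp
  show "positive (sets (sticky_measure M lam \<sigma> \<alpha> \<beta>))
      (\<lambda>S. emeasure (weighted lam \<alpha>) S + emeasure (weighted \<sigma> \<beta>) (S \<inter> boundary M))"
    by (simp add: positive_def)
  show "countably_additive (sets (sticky_measure M lam \<sigma> \<alpha> \<beta>))
      (\<lambda>S. emeasure (weighted lam \<alpha>) S + emeasure (weighted \<sigma> \<beta>) (S \<inter> boundary M))"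
  proof (rule countably_additiveI)
    fix E :: "nat \<Rightarrow> 'a set"
    assume E: "range E \<subseteq> sets (sticky_measure M lam \<sigma> \<alpha> \<beta>)" "disjoint_family E"
    have 1: "(\<Sum>n. emeasure (weighted lam \<alpha>) (E n)) = emeasure (weighted lam \<alpha>) (\<Union> (range E))"
      using E eq lam by (intro suminf_emeasure) auto
    have 2: "(\<Sum>n. emeasure (weighted \<sigma> \<beta>) (E n \<inter> boundary M)) =
        emeasure (weighted \<sigma> \<beta>) (\<Union>n. E n \<inter> boundary M)"
    proof (rule suminf_emeasure)
      show "range (\<lambda>n. E n \<inter> boundary M) \<subseteq> sets (weighted \<sigma> \<beta>)"
      proof safe
        fix n
        have "E n \<in> sets (borel_of (mtop M))"
          using E(1) eq by auto
        from sets_borel_of_Int[OF this] show "E n \<inter> boundary M \<in> sets (weighted \<sigma> \<beta>)"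
          using \<sigma> by simp
      qed
      show "disjoint_family (\<lambda>n. E n \<inter> boundary M)"
        using E(2) by (auto simp: disjoint_family_on_def)
    qed
    have 3: "(\<Union>n. E n \<inter> boundary M) = \<Union> (range E) \<inter> boundary M"
      by blast
    have "(\<Sum>n. emeasure (weighted lam \<alpha>) (E n) + emeasure (weighted \<sigma> \<beta>) (E n \<inter> boundary M)) =
        (\<Sum>n. emeasure (weighted lam \<alpha>) (E n)) + (\<Sum>n. emeasure (weighted \<sigma> \<beta>) (E n \<inter> boundary M))"
      by (rule suminf_add[symmetric]) auto
    then show "(\<Sum>n. emeasure (weighted lam \<alpha>) (E n) + emeasure (weighted \<sigma> \<beta>) (E n \<inter> boundary M)) =
        emeasure (weighted lam \<alpha>) (\<Union> (range E)) +
        emeasure (weighted \<sigma> \<beta>) (\<Union> (range E) \<inter> boundary M)"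
      by (simp only: 1 2 3)
  qed
qed


section \<open>Functional inequalities\<close>

definition Var :: "'a measure \<Rightarrow> ('a \<Rightarrow> real) \<Rightarrow> real" where
  "Var \<nu> f = (\<integral>x. (f x)\<^sup>2 \<partial>\<nu>) - (\<integral>x. f x \<partial>\<nu>)\<^sup>2"

text \<open>\<open>Ent_sq \<nu> f\<close> is the entropy of \<open>f\<^sup>2\<close>; \<open>0 * ln 0 = 0\<close>.\<close>

definition Ent_sq :: "'a measure \<Rightarrow> ('a \<Rightarrow> real) \<Rightarrow> real" where
  "Ent_sq \<nu> f = (\<integral>x. (f x)\<^sup>2 * ln ((f x)\<^sup>2) \<partial>\<nu>) - (\<integral>x. (f x)\<^sup>2 \<partial>\<nu>) * ln (\<integral>x. (f x)\<^sup>2 \<partial>\<nu>)"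

text \<open>The smallest \<open>c\<close> with \<open>\<Phi> f \<le> c * \<E> f\<close> for all \<open>f \<in> F\<close>, and \<open>\<infinity>\<close> if there is no such \<open>c\<close>;
  a finite infimum is attained.\<close>

definition best_constant ::
  "('a \<Rightarrow> real) set \<Rightarrow> (('a \<Rightarrow> real) \<Rightarrow> real) \<Rightarrow> (('a \<Rightarrow> real) \<Rightarrow> real) \<Rightarrow> ereal" where
  "best_constant F \<Phi> \<E> = (INF c\<in>{c::real. \<forall>f\<in>F. \<Phi> f \<le> c * \<E> f}. ereal c)"

definition C_bulk :: "('a, 'n::finite) rmanifold \<Rightarrow> 'a measure \<Rightarrow> ereal" where
  "C_bulk M \<nu> = best_constant (C1 M) (Var \<nu>) (\<lambda>f. \<integral>x. grad_sq M f x \<partial>\<nu>)"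

definition L_bulk :: "('a, 'n::finite) rmanifold \<Rightarrow> 'a measure \<Rightarrow> ereal" where
  "L_bulk M \<nu> = best_constant (C1 M) (Ent_sq \<nu>) (\<lambda>f. \<integral>x. grad_sq M f x \<partial>\<nu>)"

definition C_surface :: "('a, 'n::finite) rmanifold \<Rightarrow> 'a measure \<Rightarrow> ereal" where
  "C_surface M \<nu> = best_constant (C1_boundary M) (Var \<nu>) (\<lambda>f. \<integral>x. tangential_grad_sq M f x \<partial>\<nu>)"

definition L_surface :: "('a, 'n::finite) rmanifold \<Rightarrow> 'a measure \<Rightarrow> ereal" where
  "L_surface M \<nu> = best_constant (C1_boundary M) (Ent_sq \<nu>) (\<lambda>f. \<integral>x. tangential_grad_sq M f x \<partial>\<nu>)"

definition C_hat :: "('a, 'n::finite) rmanifold \<Rightarrow> 'a measure \<Rightarrow> ('a \<Rightarrow> real) \<Rightarrow> 'a measure \<Rightarrow> ereal" where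
  "C_hat M lam \<alpha> \<mu> = best_constant (C1 M) (Var \<mu>) (\<lambda>f. \<integral>x. grad_sq M f x * \<alpha> x \<partial>lam)"


section \<open>Lebesgue and Sobolev spaces\<close>

definition Lp_space :: "real \<Rightarrow> 'a measure \<Rightarrow> ('a \<Rightarrow> real) set" where
  "Lp_space p \<nu> = {u \<in> borel_measurable \<nu>. integrable \<nu> (\<lambda>x. \<bar>u x\<bar> powr p)}"

definition Lp_norm :: "real \<Rightarrow> 'a measure \<Rightarrow> ('a \<Rightarrow> real) \<Rightarrow> real" where
  "Lp_norm p \<nu> u = (\<integral>x. \<bar>u x\<bar> powr p \<partial>\<nu>) powr (1 / p)"

text \<open>\<open>W^{1,2}(\<nu>)\<close> as the closure of the \<open>C^1\<close> functions \<open>F\<close> under the norm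
  \<open>(\<integral> f\<^sup>2 d\<nu> + \<integral> \<Gamma> f d\<nu>)^{1/2}\<close>, where \<open>\<Gamma> f\<close> is the squared length of the gradient. One definition
  serves the bulk and the boundary, with and without weights; for a weight vanishing on a null set
  there is in general no definition through distributional derivatives, as functions square
  integrable for the weighted measure need not be locally integrable. When the energy is closable
  (as it is for weights whose square root is in \<open>W^{1,2}\<close>), all approximating sequences of \<open>u\<close>
  give the same limit in \<open>W12_norm\<close>.\<close>

definition W12_norm_C1 ::
  "(('a \<Rightarrow> real) \<Rightarrow> 'a \<Rightarrow> real) \<Rightarrow> 'a measure \<Rightarrow> ('a \<Rightarrow> real) \<Rightarrow> real" where
  "W12_norm_C1 \<Gamma> \<nu> f = sqrt ((\<integral>x. (f x)\<^sup>2 \<partial>\<nu>) + (\<integral>x. \<Gamma> f x \<partial>\<nu>))"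

definition W12_approx ::
  "('a \<Rightarrow> real) set \<Rightarrow> (('a \<Rightarrow> real) \<Rightarrow> 'a \<Rightarrow> real) \<Rightarrow> 'a measure \<Rightarrow>
   (nat \<Rightarrow> 'a \<Rightarrow> real) \<Rightarrow> ('a \<Rightarrow> real) \<Rightarrow> bool" where
  "W12_approx F \<Gamma> \<nu> f u \<longleftrightarrow>
     (\<forall>n. f n \<in> F) \<and>
     (\<forall>\<epsilon>>0. \<exists>N. \<forall>m\<ge>N. \<forall>n\<ge>N. W12_norm_C1 \<Gamma> \<nu> (\<lambda>x. f m x - f n x) < \<epsilon>) \<and>
     (\<lambda>n. Lp_norm 2 \<nu> (\<lambda>x. f n x - u x)) \<longlonglongrightarrow> 0"

definition W12 ::
  "('a \<Rightarrow> real) set \<Rightarrow> (('a \<Rightarrow> real) \<Rightarrow> 'a \<Rightarrow> real) \<Rightarrow> 'a measure \<Rightarrow> ('a \<Rightarrow> real) set" where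
  "W12 F \<Gamma> \<nu> = {u \<in> Lp_space 2 \<nu>. \<exists>f. W12_approx F \<Gamma> \<nu> f u}"

definition W12_norm ::
  "('a \<Rightarrow> real) set \<Rightarrow> (('a \<Rightarrow> real) \<Rightarrow> 'a \<Rightarrow> real) \<Rightarrow> 'a measure \<Rightarrow> ('a \<Rightarrow> real) \<Rightarrow> real" where
  "W12_norm F \<Gamma> \<nu> u =
     Inf {l. \<exists>f. W12_approx F \<Gamma> \<nu> f u \<and> (\<lambda>n. W12_norm_C1 \<Gamma> \<nu> (f n)) \<longlonglongrightarrow> l}"

text \<open>Operators on a function space \<open>X\<close> with norm \<open>N\<close> into \<open>L^p(\<nu>)\<close>; linearity is understood
  almost everywhere. The embeddings are the case of the identity.\<close>

definition linear_into_Lp ::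
  "('a \<Rightarrow> real) set \<Rightarrow> (('a \<Rightarrow> real) \<Rightarrow> 'a \<Rightarrow> real) \<Rightarrow> real \<Rightarrow> 'a measure \<Rightarrow> bool" where
  "linear_into_Lp X T p \<nu> \<longleftrightarrow>
     (\<forall>u\<in>X. T u \<in> Lp_space p \<nu>) \<and>
     (\<forall>u\<in>X. \<forall>v\<in>X. \<forall>a b. AE x in \<nu>. T (\<lambda>y. a * u y + b * v y) x = a * T u x + b * T v x)"

definition bounded_into_Lp ::
  "('a \<Rightarrow> real) set \<Rightarrow> (('a \<Rightarrow> real) \<Rightarrow> real) \<Rightarrow> (('a \<Rightarrow> real) \<Rightarrow> 'a \<Rightarrow> real) \<Rightarrow> real \<Rightarrow>
   'a measure \<Rightarrow> bool" where
  "bounded_into_Lp X N T p \<nu> \<longleftrightarrow>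
     linear_into_Lp X T p \<nu> \<and> (\<exists>K. \<forall>u\<in>X. Lp_norm p \<nu> (T u) \<le> K * N u)"

definition compact_into_Lp ::
  "('a \<Rightarrow> real) set \<Rightarrow> (('a \<Rightarrow> real) \<Rightarrow> real) \<Rightarrow> (('a \<Rightarrow> real) \<Rightarrow> 'a \<Rightarrow> real) \<Rightarrow> real \<Rightarrow>
   'a measure \<Rightarrow> bool" where
  "compact_into_Lp X N T p \<nu> \<longleftrightarrow>
     linear_into_Lp X T p \<nu> \<and>
     (\<forall>u R. (\<forall>n. u n \<in> X \<and> N (u n) \<le> R) \<longrightarrow>
        (\<exists>r v. strict_mono (r :: nat \<Rightarrow> nat) \<and> v \<in> Lp_space p \<nu> \<and>
           (\<lambda>n. Lp_norm p \<nu> (\<lambda>x. T (u (r n)) x - v x)) \<longlonglongrightarrow> 0))"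

abbreviation W12_bulk :: "('a, 'n::finite) rmanifold \<Rightarrow> 'a measure \<Rightarrow> ('a \<Rightarrow> real) set" where
  "W12_bulk M \<nu> \<equiv> W12 (C1 M) (grad_sq M) \<nu>"

abbreviation W12_bulk_norm :: "('a, 'n::finite) rmanifold \<Rightarrow> 'a measure \<Rightarrow> ('a \<Rightarrow> real) \<Rightarrow> real" where
  "W12_bulk_norm M \<nu> \<equiv> W12_norm (C1 M) (grad_sq M) \<nu>"

abbreviation W12_surface :: "('a, 'n::finite) rmanifold \<Rightarrow> 'a measure \<Rightarrow> ('a \<Rightarrow> real) set" where
  "W12_surface M \<nu> \<equiv> W12 (C1_boundary M) (tangential_grad_sq M) \<nu>"

abbreviation W12_surface_norm :: "('a, 'n::finite) rmanifold \<Rightarrow> 'a measure \<Rightarrow> ('a \<Rightarrow> real) \<Rightarrow> real" where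
  "W12_surface_norm M \<nu> \<equiv> W12_norm (C1_boundary M) (tangential_grad_sq M) \<nu>"

text \<open>For \<open>d = 2\<close> the exponent \<open>(2 d - 2) / (d - 2)\<close> is read as \<open>\<infinity>\<close>, with \<open>p\<close> finite. The trace is the
  operator on \<open>W^{1,2}\<close> that restricts \<open>C^1\<close> functions to the boundary.\<close>

definition sobolev_embeddings ::
  "('a, 'n::finite) rmanifold \<Rightarrow> 'a measure \<Rightarrow> 'a measure \<Rightarrow> ('a \<Rightarrow> real) \<Rightarrow> ('a \<Rightarrow> real) \<Rightarrow> bool" where
  "sobolev_embeddings M lam \<sigma> \<alpha> \<beta> \<longleftrightarrow>
     (let W = W12_bulk M (weighted lam \<alpha>); N = W12_bulk_norm M (weighted lam \<alpha>);
          W' = W12_surface M (weighted \<sigma> \<beta>); N' = W12_surface_norm M (weighted \<sigma> \<beta>);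
          d = real CARD('n)
      in compact_into_Lp W N (\<lambda>u. u) 2 (weighted lam \<alpha>) \<and>
         (\<forall>p. 2 \<le> p \<and> (d > 2 \<longrightarrow> p \<le> (2 * d - 2) / (d - 2)) \<longrightarrow>
            bounded_into_Lp W N (\<lambda>u. u) p (weighted lam \<beta>)) \<and>
         compact_into_Lp W' N' (\<lambda>u. u) 2 (weighted \<sigma> \<beta>) \<and>
         (\<exists>T. (\<forall>f\<in>C1 M. AE x in weighted \<sigma> \<beta>. T f x = f x) \<and>
              compact_into_Lp W N T 2 (weighted \<sigma> \<beta>)))"

end

theory Submission
  imports Defs
begin

text \<open>
  The measure \<open>\<mu>\<close> is the mixture of the probability measures \<open>lam_\<alpha>\<close> and \<open>\<sigma>_\<beta>\<close> with weights \<open>A\<close> and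
  \<open>B\<close>. The law of total variance splits the variance for a mixture into the weighted mean
  of the two variances and the variance of the two means, and the latter is \<open>A * B\<close> times the squared
  difference of the means (lemma \<open>Var_mixture\<close>). If \<open>E f\<close> denotes the energy of \<open>f\<close> for \<open>lam_\<alpha>\<close>,
  the three terms are at most \<open>A * C * E f\<close>, \<open>B * K_bd * E f\<close> and \<open>A * B * K1 * E f\<close>, where
  \<open>C\<close> is the Poincare constant of \<open>lam_\<alpha>\<close>. Undoing the normalisation of \<open>lam_\<alpha>\<close> turns \<open>E f\<close> into
  \<open>1 / A\<close> times the energy for \<open>\<alpha> d\<lambda>\<close>; dividing the sum of the coefficients by \<open>A\<close> gives
  \<open>C + B * K_bd / A + B * K1\<close>.

  Two analytic points need care. The law of total variance rests on the additivity of the integral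
  in the measure, so \<open>f\<close> and \<open>f\<^sup>2\<close> have to be integrable. They are bounded, since a \<open>C\<^sup>1\<close> function
  is continuous (lemma \<open>C1_continuous_map\<close>) and the manifold is compact. The integral for the
  sticky measure then splits by lemma \<open>integral_sticky_measure\<close>.

  The second point is the relation between \<open>E f\<close> and the energy for \<open>\<alpha> d\<lambda>\<close>. The squared length of
  the gradient is computed in a chart selected arbitrarily at each point. Rather than showing its
  measurability, the proof uses only its sign, which suffices to bound \<open>A * E f\<close> by the energy for
  \<open>\<alpha> d\<lambda>\<close> (lemma \<open>integral_weighted_le\<close>). To insert this inequality, the constant in front of the energy must
  be nonnegative. This follows from the finiteness of \<open>C\<close>: if all energies vanished, \<open>C\<close> would be
  infinite (lemma \<open>best_constant_finite_imp_energy\<close>), and the three inequalities for a function of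
  positive energy, whose left-hand sides are nonnegative, give the signs of \<open>C\<close>, \<open>K_bd\<close> and \<open>K1\<close>.
\<close>


section \<open>Continuity of differentiable functions\<close>

text \<open>Continuity is local, and locally the function is the restriction of a continuous extension.\<close>

lemma Ck_on_imp_continuous_on:
  assumes "Ck_on k f V"
  shows "continuous_on V f"
  unfolding continuous_on_eq_continuous_within
proof
  fix x assume x: "x \<in> V"
  then obtain W F where W: "open W" "x \<in> W" and F: "Ck_open 0 F W" "\<forall>y\<in>V \<inter> W. F y = f y"
    using assms unfolding Ck_on_def by (metis zero_enat_def zero_le)
  have "continuous_on (V \<inter> W) f"
    using F by (metis Ck_open.simps(1) continuous_on_cong continuous_on_subset inf_le2)
  then have "continuous (at x within V \<inter> W) f"
    using x W by (simp add: continuous_on_eq_continuous_within)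
  then show "continuous (at x within V) f"
    using W at_within_nhd[of x W "V \<inter> W" V] by (simp add: continuous_within Int_assoc)
qed

text \<open>In each chart \<open>f\<close> is the coordinate map, a homeomorphism onto its image, followed by the
  coordinate expression of \<open>f\<close>. The chart domains form an open cover, over which the local
  statements are pasted together.\<close>

lemma C1_continuous_map:
  assumes M: "smooth_manifold_with_boundary M" and f: "f \<in> C1 M"
  shows "continuous_map (mtop M) euclideanreal f"
proof -
  have charts: "topspace (mtop M) = \<Union> (fst ` atlas M)"
    "\<And>c. c \<in> atlas M \<Longrightarrow> openin (mtop M) (fst c)"
    "\<And>c. c \<in> atlas M \<Longrightarrow>
      homeomorphic_map (subtopology (mtop M) (fst c)) (top_of_set (snd c ` fst c)) (snd c)"
    using M unfolding smooth_manifold_with_boundary_def by auto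
  have loc: "continuous_map (subtopology (mtop M) (fst c)) euclideanreal f" if c: "c \<in> atlas M" for c
  proof -
    have "inj_on (snd c) (fst c)"
      using homeomorphic_imp_injective_map[OF charts(3)[OF c]] openin_subset[OF charts(2)[OF c]]
      by (simp add: Int_absorb1)
    then have eq: "(f \<circ> chart_inv c \<circ> snd c) x = f x" if "x \<in> fst c" for x
      using that by simp
    have "continuous_on (snd c ` fst c) (f \<circ> chart_inv c)"
      using f c unfolding C1_def by (blast intro: Ck_on_imp_continuous_on)
    then have "continuous_map (top_of_set (snd c ` fst c)) euclideanreal (f \<circ> chart_inv c)"
      by simp
    from continuous_map_compose[OF homeomorphic_imp_continuous_map[OF charts(3)[OF c]] this]
    show ?thesis
      by (rule continuous_map_eq) (use eq in auto)
  qed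
  show ?thesis
    by (rule pasting_lemma[where I = "atlas M" and T = fst and f = "\<lambda>_. f"])
       (use charts loc in auto)
qed

lemma continuous_map_borel_measurable:
  fixes f :: "'a \<Rightarrow> 'b::topological_space"
  assumes "continuous_map X euclidean f"
  shows "f \<in> borel_measurable (borel_of X)"
proof (rule borel_measurableI)
  fix S :: "'b set" assume "open S"
  then have "openin X {x \<in> topspace X. f x \<in> S}"
    using assms by (simp add: openin_continuous_map_preimage)
  moreover have "f -` S \<inter> space (borel_of X) = {x \<in> topspace X. f x \<in> S}"
    by auto
  ultimately show "f -` S \<inter> space (borel_of X) \<in> sets (borel_of X)"
    by (simp add: sets_borel_of sigma_sets.Basic)
qed

lemma compact_space_continuous_map_bounded:
  fixes f :: "'a \<Rightarrow> real"
  assumes "compact_space X" "continuous_map X euclideanreal f"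
  obtains K where "\<And>x. x \<in> topspace X \<Longrightarrow> \<bar>f x\<bar> \<le> K"
proof -
  have "compactin euclideanreal (f ` topspace X)"
    using assms image_compactin compact_space_def by blast
  then have "bounded (f ` topspace X)"
    by (simp add: compact_imp_bounded)
  then show thesis
    using that by (auto simp: bounded_iff)
qed


section \<open>Integration with respect to the sticky measure\<close>

text \<open>Additivity in the measure is the hypothesis for indicator functions and passes to all
  nonnegative measurable functions by linearity and monotone convergence.\<close>

lemma nn_integral_add_measure:
  assumes sets: "sets N1 = sets N" "sets N2 = sets N"
    and emeasure: "\<And>S. S \<in> sets N \<Longrightarrow> emeasure N S = emeasure N1 S + emeasure N2 S"
    and f: "f \<in> borel_measurable N"
  shows "(\<integral>\<^sup>+x. f x \<partial>N) = (\<integral>\<^sup>+x. f x \<partial>N1) + (\<integral>\<^sup>+x. f x \<partial>N2)"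
  using f
proof (induction rule: borel_measurable_induct)
  case (cong f g)
  have sp: "space N1 = space N" "space N2 = space N"
    using sets sets_eq_imp_space_eq by blast+
  show ?case
    using cong(3,4) nn_integral_cong[of N f g] nn_integral_cong[of N1 f g]
      nn_integral_cong[of N2 f g] sp by simp
next
  case (set S)
  then show ?case
    using sets emeasure by simp
next
  case (mult u c)
  then show ?case
    using sets by (simp add: nn_integral_cmult distrib_left cong: measurable_cong_sets)
next
  case (add u v)
  then show ?case
    using sets by (simp add: nn_integral_add add_ac cong: measurable_cong_sets)
next
  case (seq U)
  have U: "U i \<in> borel_measurable N1" "U i \<in> borel_measurable N2" for i
    using seq(1) sets by (simp_all cong: measurable_cong_sets)
  have *: "(\<integral>\<^sup>+x. (SUP i. U i) x \<partial>K) = (SUP i. \<integral>\<^sup>+x. U i x \<partial>K)"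
    if "\<And>i. U i \<in> borel_measurable K" for K
    unfolding SUP_apply using seq(3) that by (rule nn_integral_monotone_convergence_SUP)
  have mono: "incseq (\<lambda>i. \<integral>\<^sup>+x. U i x \<partial>K)" for K
    using seq(3) by (intro monoI nn_integral_mono) (auto simp: le_fun_def mono_def)
  show ?case
    by (simp only: *[OF seq(1)] *[OF U(1)] *[OF U(2)] seq.IH ennreal_SUP_add[OF mono mono])
qed

lemma integral_add_measure:
  fixes f :: "'a \<Rightarrow> real"
  assumes sets: "sets N1 = sets N" "sets N2 = sets N"
    and emeasure: "\<And>S. S \<in> sets N \<Longrightarrow> emeasure N S = emeasure N1 S + emeasure N2 S"
    and f: "integrable N1 f" "integrable N2 f"
  shows "(\<integral>x. f x \<partial>N) = (\<integral>x. f x \<partial>N1) + (\<integral>x. f x \<partial>N2)"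
proof -
  have meas: "f \<in> borel_measurable N"
    using f(1) sets by (auto dest: borel_measurable_integrable cong: measurable_cong_sets)
  have nn: "(\<integral>\<^sup>+x. ennreal (g x) \<partial>N) = (\<integral>\<^sup>+x. ennreal (g x) \<partial>N1) + (\<integral>\<^sup>+x. ennreal (g x) \<partial>N2)"
    if "g \<in> borel_measurable N" for g :: "'a \<Rightarrow> real"
    using that by (intro nn_integral_add_measure[OF sets emeasure]) auto
  have fin: "(\<integral>\<^sup>+x. ennreal (norm (f x)) \<partial>N1) < \<infinity>" "(\<integral>\<^sup>+x. ennreal (norm (f x)) \<partial>N2) < \<infinity>"
    using f by (simp_all add: integrable_iff_bounded)
  have N: "integrable N f"
    using meas fin by (auto simp: integrable_iff_bounded nn)
  have lt: "(\<integral>\<^sup>+x. ennreal (g x) \<partial>K) < top"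
    if "\<And>x. g x \<le> norm (f x)" "(\<integral>\<^sup>+x. ennreal (norm (f x)) \<partial>K) < \<infinity>" for K and g :: "'a \<Rightarrow> real"
    using nn_integral_mono[of K "\<lambda>x. ennreal (g x)" "\<lambda>x. ennreal (norm (f x))"] that
    by (simp add: ennreal_leI order_le_less_trans)
  show ?thesis
    using lt[OF _ fin(1), of f] lt[OF _ fin(2), of f]
      lt[OF _ fin(1), of "\<lambda>x. - f x"] lt[OF _ fin(2), of "\<lambda>x. - f x"] meas
    by (simp add: real_lebesgue_integral_def N f nn enn2real_plus)
qed

lemma boundary_subset_topspace:
  assumes "smooth_manifold_with_boundary M"
  shows "boundary M \<subseteq> topspace (mtop M)"
  using assms by (auto simp: smooth_manifold_with_boundary_def boundary_def)

text \<open>The surface measure lives on the boundary as its own space; this is the map that carries it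
  over to the whole manifold.\<close>

lemma boundary_inclusion_measurable:
  assumes M: "smooth_manifold_with_boundary M"
    and \<sigma>: "space \<sigma> = boundary M" "sets \<sigma> = sets (borel_of (subtopology (mtop M) (boundary M)))"
  shows "(\<lambda>x. x) \<in> \<sigma> \<rightarrow>\<^sub>M borel_of (mtop M)"
  using boundary_subset_topspace[OF M] \<sigma> sets_borel_of_Int[of _ "mtop M" "boundary M"]
  by (auto intro!: measurableI)

text \<open>The sticky measure is the sum of the weighted volume and the image of the weighted surface
  measure under the inclusion of the boundary, and the integral for an image measure is computed on
  the original space.\<close>

lemma integral_sticky_measure:
  fixes f :: "'a \<Rightarrow> real"
  assumes M: "smooth_manifold_with_boundary M"
    and lam: "sets lam = sets (borel_of (mtop M))"
    and \<sigma>: "space \<sigma> = boundary M" "sets \<sigma> = sets (borel_of (subtopology (mtop M) (boundary M)))"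
    and f: "integrable (weighted lam \<alpha>) f" "integrable (weighted \<sigma> \<beta>) f"
  shows "(\<integral>x. f x \<partial>sticky_measure M lam \<sigma> \<alpha> \<beta>) =
    (\<integral>x. f x \<partial>weighted lam \<alpha>) + (\<integral>x. f x \<partial>weighted \<sigma> \<beta>)"
proof -
  define N where "N = distr (weighted \<sigma> \<beta>) (borel_of (mtop M)) (\<lambda>x. x)"
  have incl: "(\<lambda>x. x) \<in> weighted \<sigma> \<beta> \<rightarrow>\<^sub>M borel_of (mtop M)"
    using boundary_inclusion_measurable[OF M \<sigma>] by simp
  have meas: "f \<in> borel_measurable (borel_of (mtop M))"
    using borel_measurable_integrable[OF f(1)] lam by (simp cong: measurable_cong_sets)
  have sets: "sets (sticky_measure M lam \<sigma> \<alpha> \<beta>) = sets (borel_of (mtop M))"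
    unfolding sticky_measure_def by (metis sets.sets_measure_of_eq space_borel_of)
  have em: "emeasure (sticky_measure M lam \<sigma> \<alpha> \<beta>) S = emeasure (weighted lam \<alpha>) S + emeasure N S"
    if "S \<in> sets (sticky_measure M lam \<sigma> \<alpha> \<beta>)" for S
    using that unfolding sets N_def
    by (simp add: emeasure_sticky_measure[OF lam \<sigma>(2)] emeasure_distr[OF incl] \<sigma>(1))
  have "(\<integral>x. f x \<partial>sticky_measure M lam \<sigma> \<alpha> \<beta>) = (\<integral>x. f x \<partial>weighted lam \<alpha>) + (\<integral>x. f x \<partial>N)"
    by (rule integral_add_measure[OF _ _ em])
       (use lam sets f meas incl in \<open>auto simp: N_def integrable_distr_eq\<close>)
  then show ?thesis
    using integral_distr[OF incl meas] by (simp add: N_def)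
qed


section \<open>Normalised weights\<close>

lemma prob_space_weighted:
  fixes w :: "'a \<Rightarrow> real"
  assumes "AE x in \<nu>. 0 < w x" and Z: "Z = (\<integral>x. w x \<partial>\<nu>)" "0 < Z"
  shows "prob_space (weighted \<nu> (\<lambda>x. w x / Z))"
proof
  have w: "integrable \<nu> w"
    using Z not_integrable_integral_eq by force
  have "emeasure (weighted \<nu> (\<lambda>x. w x / Z)) (space \<nu>) = (\<integral>\<^sup>+x. ennreal (w x / Z) \<partial>\<nu>)"
    using w by (simp add: emeasure_density cong: nn_integral_cong)
  also have "\<dots> = ennreal (\<integral>x. w x / Z \<partial>\<nu>)"
    using assms w by (intro nn_integral_eq_integral) auto
  also have "\<dots> = 1"
    using Z by simp
  finally show "emeasure (weighted \<nu> (\<lambda>x. w x / Z)) (space (weighted \<nu> (\<lambda>x. w x / Z))) = 1"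
    by simp
qed

text \<open>Normalising the weight rescales the integral of every function: for a function that is not
  measurable both integrals take the default value \<open>0\<close>.\<close>

lemma
  fixes w g :: "'a \<Rightarrow> real"
  assumes w: "AE x in \<nu>. 0 < w x" "w \<in> borel_measurable \<nu>" and "0 < Z"
  shows integrable_weighted_normalised:
      "integrable (weighted \<nu> (\<lambda>x. w x / Z)) g \<longleftrightarrow> integrable (weighted \<nu> w) g" (is ?thesis1)
    and integral_weighted_normalised:
      "(\<integral>x. g x \<partial>weighted \<nu> w) = Z * (\<integral>x. g x \<partial>weighted \<nu> (\<lambda>x. w x / Z))" (is ?thesis2)
proof -
  have nonneg: "AE x in \<nu>. 0 \<le> w x" "AE x in \<nu>. 0 \<le> w x / Z"
    using w(1) \<open>0 < Z\<close> by auto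
  have scale: "integrable \<nu> (\<lambda>x. w x * g x / Z) \<longleftrightarrow> integrable \<nu> (\<lambda>x. w x * g x)"
    using \<open>0 < Z\<close> by (simp add: divide_inverse)
  have "?thesis1 \<and> ?thesis2"
  proof (cases "g \<in> borel_measurable \<nu>")
    case True
    then show ?thesis
      using nonneg w \<open>0 < Z\<close> by (simp add: integrable_density integral_density scale)
  next
    case False
    then have "\<not> integrable (weighted \<nu> v) g" for v
      by (auto dest: borel_measurable_integrable)
    then show ?thesis
      by (simp add: not_integrable_integral_eq)
  qed
  then show ?thesis1 ?thesis2
    by blast+
qed

text \<open>For measurable \<open>g\<close> this is the equality that defines a density. Otherwise the left-hand side
  is \<open>0\<close> by convention, while the product \<open>g x * w x\<close> may still be measurable, as \<open>g\<close> can be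
  irregular where \<open>w\<close> vanishes; so only an inequality remains.\<close>

lemma integral_weighted_le:
  fixes w g :: "'a \<Rightarrow> real"
  assumes w: "AE x in \<nu>. 0 < w x" "w \<in> borel_measurable \<nu>"
    and g: "\<And>x. x \<in> space \<nu> \<Longrightarrow> 0 \<le> g x"
  shows "(\<integral>x. g x \<partial>weighted \<nu> w) \<le> (\<integral>x. g x * w x \<partial>\<nu>)"
proof (cases "g \<in> borel_measurable \<nu>")
  case True
  have "AE x in \<nu>. 0 \<le> w x"
    using w(1) by auto
  then show ?thesis
    using True w by (simp add: integral_density mult.commute)
next
  case False
  then have "\<not> integrable (weighted \<nu> w) g"
    by (auto dest: borel_measurable_integrable)
  moreover have "0 \<le> (\<integral>x. g x * w x \<partial>\<nu>)"
  proof (rule integral_nonneg_AE)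
    show "AE x in \<nu>. 0 \<le> g x * w x"
      using w(1) AE_space by eventually_elim (use g in auto)
  qed
  ultimately show ?thesis
    by (simp add: not_integrable_integral_eq)
qed


section \<open>Variances, energies and optimal constants\<close>

lemma Var_nonneg:
  assumes "prob_space \<nu>" "integrable \<nu> f" "integrable \<nu> (\<lambda>x. (f x)\<^sup>2)"
  shows "0 \<le> Var \<nu> f"
  using prob_space.variance_eq[OF assms] prob_space.variance_positive[OF assms(1), of f]
  by (simp add: Var_def)

text \<open>The law of total variance for two components. With \<open>m\<^sub>1\<close> and \<open>m\<^sub>2\<close> the means, the last term is
  \<open>A * m\<^sub>1\<^sup>2 + B * m\<^sub>2\<^sup>2 - (A * m\<^sub>1 + B * m\<^sub>2)\<^sup>2\<close>, which equals \<open>A * B * (m\<^sub>1 - m\<^sub>2)\<^sup>2\<close> because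
  \<open>A + B = 1\<close>.\<close>

lemma Var_mixture:
  fixes A B :: real
  assumes "A + B = 1"
    and f: "(\<integral>x. f x \<partial>\<mu>) = A * (\<integral>x. f x \<partial>\<nu>1) + B * (\<integral>x. f x \<partial>\<nu>2)"
    and f2: "(\<integral>x. (f x)\<^sup>2 \<partial>\<mu>) = A * (\<integral>x. (f x)\<^sup>2 \<partial>\<nu>1) + B * (\<integral>x. (f x)\<^sup>2 \<partial>\<nu>2)"
  shows "Var \<mu> f = A * Var \<nu>1 f + B * Var \<nu>2 f
    + A * B * ((\<integral>x. f x \<partial>\<nu>1) - (\<integral>x. f x \<partial>\<nu>2))\<^sup>2"
proof -
  have A: "A = 1 - B"
    using assms(1) by simp
  show ?thesis
    unfolding Var_def f f2 A by (simp add: power2_eq_square algebra_simps)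
qed

text \<open>The metric in any chart is positive definite, so its value on a vector with itself has a sign
  whichever vector represents the gradient.\<close>

lemma grad_sq_nonneg:
  assumes M: "riemannian_manifold_with_boundary M" and p: "p \<in> topspace (mtop M)"
  shows "0 \<le> grad_sq M f p"
proof -
  define c where "c = chart_at M p"
  have "topspace (mtop M) = \<Union> (fst ` atlas M)"
    using M unfolding riemannian_manifold_with_boundary_def smooth_manifold_with_boundary_def
    by blast
  then have "\<exists>c. c \<in> atlas M \<and> p \<in> fst c"
    using p by auto
  then have "c \<in> atlas M \<and> p \<in> fst c"
    unfolding c_def chart_at_def by (rule someI_ex)
  then have c: "c \<in> atlas M" "snd c p \<in> snd c ` fst c"
    by auto
  have "bilinear (rmetric M c (snd c p)) \<and>
      (\<forall>u v. rmetric M c (snd c p) u v = rmetric M c (snd c p) v u) \<and>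
      (\<forall>u. u \<noteq> 0 \<longrightarrow> 0 < rmetric M c (snd c p) u u)"
    using M c unfolding riemannian_manifold_with_boundary_def by blast
  then have bil: "bilinear (rmetric M c (snd c p))"
    and pos: "\<And>u. u \<noteq> 0 \<Longrightarrow> 0 < rmetric M c (snd c p) u u"
    by blast+
  have "0 \<le> rmetric M c (snd c p) v v" for v
    using pos[of v] bilinear_lzero[OF bil, of 0] by (cases "v = 0") auto
  then show ?thesis
    by (simp add: grad_sq_def Let_def c_def)
qed

text \<open>Where the energy is positive, the admissible constants are bounded below by the ratio of
  \<open>\<Phi> f\<close> and \<open>\<E> f\<close>, hence so is their infimum. Where it vanishes, the inequality reads
  \<open>\<Phi> f \<le> 0\<close> for every constant, and finiteness of the infimum provides one admissible constant.\<close>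

lemma best_constant_attained:
  assumes finite: "\<bar>best_constant F \<Phi> \<E>\<bar> \<noteq> \<infinity>" and f: "f \<in> F" and energy: "0 \<le> \<E> f"
  shows "\<Phi> f \<le> real_of_ereal (best_constant F \<Phi> \<E>) * \<E> f"
proof (cases "\<E> f = 0")
  case True
  have "{c::real. \<forall>f\<in>F. \<Phi> f \<le> c * \<E> f} \<noteq> {}"
  proof
    assume "{c::real. \<forall>f\<in>F. \<Phi> f \<le> c * \<E> f} = {}"
    then have "best_constant F \<Phi> \<E> = \<infinity>"
      by (simp only: best_constant_def image_empty Inf_empty top_ereal_def)
    then show False
      using finite by simp
  qed
  then show ?thesis
    using f True by auto
next
  case False
  have "ereal (\<Phi> f / \<E> f) \<le> best_constant F \<Phi> \<E>"
    unfolding best_constant_def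
    using f energy False by (intro INF_greatest) (auto simp: field_simps)
  then have "\<Phi> f / \<E> f \<le> real_of_ereal (best_constant F \<Phi> \<E>)"
    using finite by (metis ereal_less_eq(3) ereal_real')
  then show ?thesis
    using energy False by (simp add: field_simps)
qed

lemma best_constant_le:
  assumes "\<And>f. f \<in> F \<Longrightarrow> \<Phi> f \<le> c * \<E> f"
  shows "best_constant F \<Phi> \<E> \<le> ereal c"
  unfolding best_constant_def using assms by (intro INF_lower) auto

text \<open>If all energies vanish, the admissible constants are either all real numbers or none, so their
  infimum is infinite: from an attained value \<open>C\<close> one could pass to the smaller \<open>C - 1\<close>.\<close>

lemma best_constant_finite_imp_energy:
  assumes finite: "\<bar>best_constant F \<Phi> \<E>\<bar> \<noteq> \<infinity>"
  obtains f where "f \<in> F" "\<E> f \<noteq> 0"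
proof (rule ccontr)
  assume "\<not> thesis"
  then have zero: "\<E> f = 0" if "f \<in> F" for f
    using that \<open>\<And>f. f \<in> F \<Longrightarrow> \<E> f \<noteq> 0 \<Longrightarrow> thesis\<close> by blast
  obtain C where C: "best_constant F \<Phi> \<E> = ereal C"
    using finite by (cases "best_constant F \<Phi> \<E>") auto
  have "best_constant F \<Phi> \<E> \<le> ereal (C - 1)"
    using best_constant_attained[OF finite] zero by (intro best_constant_le) fastforce
  then show False
    using C by simp
qed


section \<open>The Poincare inequality for the sticky measure\<close>

theorem proposition2p6:
  fixes M :: "('a, 'n::finite) rmanifold"
    and lam \<sigma> \<mu> lam_\<alpha> \<sigma>_\<beta> :: "'a measure"
    and \<alpha> \<beta> :: "'a \<Rightarrow> real"
    and A B K1 K_bd :: real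
  assumes dim: "CARD('n) \<ge> 2"
    and manifold: "riemannian_manifold_with_boundary M"
    and compact: "compact_space (mtop M)"
    and connected: "connected_space (mtop M)"
    and connected_boundary: "connectedin (mtop M) (boundary M)"
    and volume: "riemannian_volume M lam"
    and surface: "hausdorff_surface_measure M \<sigma>"
    and A: "A = (\<integral>x. \<alpha> x \<partial>lam)"
    and B: "B = (\<integral>x. \<beta> x \<partial>\<sigma>)"
    and lam_\<alpha>: "lam_\<alpha> = weighted lam (\<lambda>x. \<alpha> x / A)"
    and \<sigma>_\<beta>: "\<sigma>_\<beta> = weighted \<sigma> (\<lambda>x. \<beta> x / B)"
    and \<mu>: "\<mu> = sticky_measure M lam \<sigma> \<alpha> \<beta>"
    and prob: "prob_space \<mu>"
    and masses: "0 < A" "A < 1" "0 < B" "B < 1" "A + B = 1"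
    and continuous: "continuous_map (mtop M) euclideanreal \<alpha>"
      "continuous_map (mtop M) euclideanreal \<beta>"
    and positive: "AE x in lam. 0 < \<alpha> x" "AE x in \<sigma>. 0 < \<beta> x"
    and sqrt_\<alpha>: "(\<lambda>x. sqrt (\<alpha> x)) \<in> W12_bulk M lam"
    and sqrt_\<beta>: "(\<lambda>x. sqrt (\<beta> x)) \<in> W12_surface M \<sigma>"
    and finite_bulk: "\<bar>C_bulk M lam_\<alpha>\<bar> \<noteq> \<infinity>" "\<bar>L_bulk M lam_\<alpha>\<bar> \<noteq> \<infinity>"
    and finite_surface: "\<bar>C_surface M \<sigma>_\<beta>\<bar> \<noteq> \<infinity>" "\<bar>L_surface M \<sigma>_\<beta>\<bar> \<noteq> \<infinity>"
    and embeddings: "sobolev_embeddings M lam \<sigma> \<alpha> \<beta>"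
    and boundary_bulk:
      "\<And>f. f \<in> C1 M \<Longrightarrow> Var \<sigma>_\<beta> f \<le> K_bd * (\<integral>x. grad_sq M f x \<partial>lam_\<alpha>)"
    and mean_difference:
      "\<And>f. f \<in> C1 M \<Longrightarrow>
        ((\<integral>x. f x \<partial>lam_\<alpha>) - (\<integral>x. f x \<partial>\<sigma>_\<beta>))\<^sup>2 \<le> K1 * (\<integral>x. grad_sq M f x \<partial>lam_\<alpha>)"
  shows "C_hat M lam \<alpha> \<mu> \<le> C_bulk M lam_\<alpha> + ereal (B * K_bd / A) + ereal (B * K1)"
proof -
  define C where "C = real_of_ereal (C_bulk M lam_\<alpha>)"
  define E where "E f = (\<integral>x. grad_sq M f x \<partial>lam_\<alpha>)" for f
  have C_bulk: "C_bulk M lam_\<alpha> = ereal C"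
    using finite_bulk(1) by (simp add: C_def ereal_real')
  have M: "smooth_manifold_with_boundary M"
    using manifold by (simp add: riemannian_manifold_with_boundary_def)
  have lam: "space lam = topspace (mtop M)" "sets lam = sets (borel_of (mtop M))"
    using volume by (auto simp: riemannian_volume_def)
  have \<sigma>: "space \<sigma> = boundary M" "sets \<sigma> = sets (borel_of (subtopology (mtop M) (boundary M)))"
    using surface by (auto simp: hausdorff_surface_measure_def)
  note incl = boundary_inclusion_measurable[OF M \<sigma>]
  have meas_lam: "h \<in> borel_measurable lam" if "continuous_map (mtop M) euclideanreal h" for h
    using continuous_map_borel_measurable[OF that] lam(2) by (simp cong: measurable_cong_sets)
  have meas_\<sigma>: "h \<in> borel_measurable \<sigma>" if "continuous_map (mtop M) euclideanreal h" for h
    using measurable_comp[OF incl continuous_map_borel_measurable[OF that]] by (simp add: comp_def)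
  note \<alpha> = positive(1) meas_lam[OF continuous(1)] masses(1)
  note \<beta> = positive(2) meas_\<sigma>[OF continuous(2)] masses(3)
  interpret lam_\<alpha>: prob_space lam_\<alpha>
    unfolding lam_\<alpha> using positive(1) A masses(1) by (rule prob_space_weighted)
  interpret \<sigma>_\<beta>: prob_space \<sigma>_\<beta>
    unfolding \<sigma>_\<beta> using positive(2) B masses(3) by (rule prob_space_weighted)

  have integrable: "integrable lam_\<alpha> h" "integrable \<sigma>_\<beta> h"
    if h: "continuous_map (mtop M) euclideanreal h" for h
  proof -
    obtain K where K: "\<And>x. x \<in> topspace (mtop M) \<Longrightarrow> \<bar>h x\<bar> \<le> K"
      using compact_space_continuous_map_bounded[OF compact h] by blast
    show "integrable lam_\<alpha> h"
      using K lam(1) meas_lam[OF h]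
      by (intro lam_\<alpha>.integrable_const_bound[of _ K]) (auto simp: lam_\<alpha> intro!: AE_I2)
    show "integrable \<sigma>_\<beta> h"
      using K \<sigma>(1) boundary_subset_topspace[OF M] meas_\<sigma>[OF h]
      by (intro \<sigma>_\<beta>.integrable_const_bound[of _ K]) (auto simp: \<sigma>_\<beta> intro!: AE_I2)
  qed
  have mixture: "(\<integral>x. h x \<partial>\<mu>) = A * (\<integral>x. h x \<partial>lam_\<alpha>) + B * (\<integral>x. h x \<partial>\<sigma>_\<beta>)"
    if h: "continuous_map (mtop M) euclideanreal h" for h
    using integrable[OF h]
    unfolding \<mu> lam_\<alpha> \<sigma>_\<beta> integrable_weighted_normalised[OF \<alpha>] integrable_weighted_normalised[OF \<beta>]
    by (simp add: integral_sticky_measure[OF M lam(2) \<sigma>] integral_weighted_normalised[OF \<alpha>]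
        integral_weighted_normalised[OF \<beta>])
  have square: "continuous_map (mtop M) euclideanreal (\<lambda>x. (f x)\<^sup>2)" if "f \<in> C1 M" for f
    using C1_continuous_map[OF M that] by (intro continuous_intros)

  have E_nonneg: "0 \<le> E f" for f
    unfolding E_def using grad_sq_nonneg[OF manifold] lam(1)
    by (intro Bochner_Integration.integral_nonneg) (simp add: lam_\<alpha>)
  have E_le: "A * E f \<le> (\<integral>x. grad_sq M f x * \<alpha> x \<partial>lam)" for f
    using integral_weighted_le[OF \<alpha>(1,2), of "grad_sq M f"] grad_sq_nonneg[OF manifold] lam(1)
    by (simp add: E_def lam_\<alpha> integral_weighted_normalised[OF \<alpha>])
  have bulk: "Var lam_\<alpha> f \<le> C * E f" if "f \<in> C1 M" for f
    using best_constant_attained[OF finite_bulk(1)[unfolded C_bulk_def] that] E_nonneg[of f]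
    by (simp add: C_def C_bulk_def E_def)

  \<comment> \<open>The sign of the constants decides whether \<open>E_le\<close> may be inserted in the last step.\<close>
  have nonneg: "0 \<le> C" "0 \<le> K_bd" "0 \<le> K1"
  proof -
    obtain f where f: "f \<in> C1 M" "E f \<noteq> 0"
      using best_constant_finite_imp_energy[OF finite_bulk(1)[unfolded C_bulk_def]]
      unfolding E_def by blast
    then have "0 < E f"
      using E_nonneg[of f] by simp
    have "0 \<le> C * E f"
      using Var_nonneg[OF lam_\<alpha>.prob_space_axioms integrable(1)[OF C1_continuous_map[OF M f(1)]]
        integrable(1)[OF square[OF f(1)]]] bulk[OF f(1)] by (rule order_trans)
    moreover have "0 \<le> K_bd * E f"
      using Var_nonneg[OF \<sigma>_\<beta>.prob_space_axioms integrable(2)[OF C1_continuous_map[OF M f(1)]]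
        integrable(2)[OF square[OF f(1)]]] boundary_bulk[OF f(1)]
      unfolding E_def by (rule order_trans)
    moreover have "0 \<le> K1 * E f"
      using zero_le_power2 mean_difference[OF f(1)] unfolding E_def by (rule order_trans)
    ultimately show "0 \<le> C" "0 \<le> K_bd" "0 \<le> K1"
      using \<open>0 < E f\<close> by (simp_all add: zero_le_mult_iff)
  qed

  have "Var \<mu> f \<le> (C + B * K_bd / A + B * K1) * (\<integral>x. grad_sq M f x * \<alpha> x \<partial>lam)"
    if f: "f \<in> C1 M" for f
  proof -
    have "Var \<mu> f = A * Var lam_\<alpha> f + B * Var \<sigma>_\<beta> f
        + A * B * ((\<integral>x. f x \<partial>lam_\<alpha>) - (\<integral>x. f x \<partial>\<sigma>_\<beta>))\<^sup>2"
      using masses(5) mixture[OF C1_continuous_map[OF M f]] mixture[OF square[OF f]]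
      by (rule Var_mixture)
    also have "\<dots> \<le> A * (C * E f) + B * (K_bd * E f) + A * B * (K1 * E f)"
      using bulk[OF f] boundary_bulk[OF f] mean_difference[OF f] masses
      unfolding E_def by (intro add_mono mult_left_mono) auto
    also have "\<dots> = (C + B * K_bd / A + B * K1) * (A * E f)"
      using masses(1) by (simp add: field_simps)
    also have "\<dots> \<le> (C + B * K_bd / A + B * K1) * (\<integral>x. grad_sq M f x * \<alpha> x \<partial>lam)"
      using E_le nonneg masses by (intro mult_left_mono) auto
    finally show ?thesis .
  qed
  then have "C_hat M lam \<alpha> \<mu> \<le> ereal (C + B * K_bd / A + B * K1)"
    unfolding C_hat_def by (rule best_constant_le)
  then show ?thesis
    by (simp add: C_bulk)
qed

end
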